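(* For every integer $n\ge 1$, $$ n B_n=\sum_{j=1}^n\bigl(B_j B_{n-j+1}-B_{j-1}B_{n-j}\bigr)\,. $$
   Context: The balancing numbers $B_n$ are defined by $B_0=0$, $B_1=1$ and $B_n=6B_{n-1}-B_{n-2}$ for $n\ge 2$. *)

theory Defs
  imports Main
begin

fun balancing :: "nat \<Rightarrow> int" where
  "balancing 0 = 0"
| "balancing (Suc 0) = 1"
| "balancing (Suc (Suc n)) = 6 * balancing (Suc n) - balancing n"

end

theory Submission
  imports Defs
begin

text \<open>Every summand equals B_n: this is the addition formula \<open>balancing_add\<close> at m
  = j - 1, k = n - j, where m + k + 1 = n. The sum is thus n copies of B_n.\<close>

lemma balancing_add:
  "balancing (Suc (m + k)) = balancing (Suc m) * balancing (Suc k) - balancing m * balancing k"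
proof (induction m arbitrary: k)
  case 0
  show ?case by simp
next
  case (Suc m)
  \<comment> \<open>One unit moves from m to k, hence \<open>arbitrary: k\<close>. Expanding B_{k+2}
    = 6 B_{k+1} - B_k and regrouping 6 B_{m+1} - B_m as B_{m+2} gives the claim.\<close>
  show ?case
    using Suc.IH[of "Suc k"] by (simp add: algebra_simps)
qed

theorem theorem1:
  fixes n :: nat
  assumes "n \<ge> 1"
  shows "int n * balancing n =
    (\<Sum>j=1..n. balancing j * balancing (n - j + 1) - balancing (j - 1) * balancing (n - j))"
proof -
  have "balancing j * balancing (n - j + 1) - balancing (j - 1) * balancing (n - j) = balancing n"
    if "j \<in> {1..n}" for j
    using balancing_add[of "j - 1" "n - j"] that by simp
  then show ?thesis by simp
qed

end
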